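(* Let $d\ge 1$, let $H$ be a subgroup of $S_d$, $K$ a subgroup of $H$, and $p\in(0,1)$ (not necessarily constant). Then there is a stochastic FO reduction $G^H(n,p^{[H:K]})\preceq G^K(n,p)$. In particular, for a constant $p\in(0,1)$, $G^H(n,p)$ obeys the FO 0--1 law.
   Context: $S_d$ acts on $d$-tuples by $g(v_1,\dots,v_d)=(v_{g^{-1}(1)},\dots,v_{g^{-1}(d)})$. For a subgroup $H\le S_d$, a $d$-uniform $H$-hypergraph on $[n]$ is a $d$-ary relation on $[n]$ contained in the set $[n]_d$ of $d$-tuples of distinct elements and invariant under the action of $H$; an $H$-hyperedge is an $H$-orbit of a tuple in $[n]_d$. The binomial $d$-uniform $H$-hypergraph $G^H(n,p)$ is the random structure over $\sigma_H=\{=,P_H\}$, $P_H$ of arity $d$, in which each $H$-orbit of $[n]_d$ is present (all its tuples satisfy $P_H$) independently with probability $p$, and no other tuples satisfy $P_H$. Stochastic FO reduction: for sequences $D=(D_n)$, $D'=(D'_n)$ of random structures with domain $[n]$ over relational signatures $\sigma,\sigma'$, a map $f$ from finite $\sigma$-structures to finite $\sigma'$-structures preserving the domain $[n]$, such that for every FO sentence $\varphi'$ over $\sigma'$ there is a FO sentence $f^{-1}(\varphi')$ over $\sigma$ with $X\models f^{-1}(\varphi')\iff f(X)\models\varphi'$ for all finite $\sigma$-structures $X$, and $|\Pr(D_n\models f^{-1}(\varphi'))-\Pr(D'_n\models\varphi')|\to0$. $D'\preceq D$ means such a reduction from $D'$ to $D$ exists. The FO 0--1 law: for every FO sentence $\varphi$,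 $\Pr(D_n\models\varphi)$ converges to $0$ or $1$. *)

theory Defs
  imports "HOL-Algebra.Sym_Groups" "HOL-Probability.Probability"
begin

text \<open>
  A relational signature is given by its arity function on a type of relation symbols.
  Equality is a logical symbol and belongs to every signature.
\<close>

type_synonym 'r signature = "'r \<Rightarrow> nat"

datatype 'r fo =
    Equal nat nat
  | Atom 'r "nat list"
  | Neg "'r fo"
  | Conj "'r fo" "'r fo"
  | Exists nat "'r fo"

fun fo_wf :: "'r signature \<Rightarrow> 'r fo \<Rightarrow> bool" where
  "fo_wf \<sigma> (Equal x y) \<longleftrightarrow> True"
| "fo_wf \<sigma> (Atom r xs) \<longleftrightarrow> length xs = \<sigma> r"
| "fo_wf \<sigma> (Neg \<phi>) \<longleftrightarrow> fo_wf \<sigma> \<phi>"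
| "fo_wf \<sigma> (Conj \<phi> \<psi>) \<longleftrightarrow> fo_wf \<sigma> \<phi> \<and> fo_wf \<sigma> \<psi>"
| "fo_wf \<sigma> (Exists x \<phi>) \<longleftrightarrow> fo_wf \<sigma> \<phi>"

fun free_vars :: "'r fo \<Rightarrow> nat set" where
  "free_vars (Equal x y) = {x, y}"
| "free_vars (Atom r xs) = set xs"
| "free_vars (Neg \<phi>) = free_vars \<phi>"
| "free_vars (Conj \<phi> \<psi>) = free_vars \<phi> \<union> free_vars \<psi>"
| "free_vars (Exists x \<phi>) = free_vars \<phi> - {x}"

definition fo_sentence :: "'r signature \<Rightarrow> 'r fo \<Rightarrow> bool" where
  "fo_sentence \<sigma> \<phi> \<longleftrightarrow> fo_wf \<sigma> \<phi> \<and> free_vars \<phi> = {}"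

datatype 'r struct = Struct (univ: "nat set") (rel: "'r \<Rightarrow> nat list set")

definition finite_structure :: "'r signature \<Rightarrow> 'r struct \<Rightarrow> bool" where
  "finite_structure \<sigma> X \<longleftrightarrow>
     finite (univ X) \<and> univ X \<noteq> {} \<and>
     (\<forall>r. rel X r \<subseteq> {v. length v = \<sigma> r \<and> set v \<subseteq> univ X})"

fun sat :: "'r struct \<Rightarrow> (nat \<Rightarrow> nat) \<Rightarrow> 'r fo \<Rightarrow> bool" where
  "sat X e (Equal x y) \<longleftrightarrow> e x = e y"
| "sat X e (Atom r xs) \<longleftrightarrow> map e xs \<in> rel X r"
| "sat X e (Neg \<phi>) \<longleftrightarrow> \<not> sat X e \<phi>"
| "sat X e (Conj \<phi> \<psi>) \<longleftrightarrow> sat X e \<phi> \<and> sat X e \<psi>"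
| "sat X e (Exists x \<phi>) \<longleftrightarrow> (\<exists>a\<in>univ X. sat X (e(x := a)) \<phi>)"

text \<open>Only used for sentences, whose truth value does not depend on the assignment.\<close>

definition models :: "'r struct \<Rightarrow> 'r fo \<Rightarrow> bool" (infix \<open>\<Turnstile>\<close> 50) where
  "X \<Turnstile> \<phi> \<longleftrightarrow> (\<forall>e. sat X e \<phi>)"

text \<open>
  Over a finite signature there are only finitely many structures with domain \<open>[n]\<close>,
  so probability mass functions cover all random structures. Universes are nonempty,
  hence the restriction to \<open>n \<ge> 1\<close>.
\<close>

definition random_structures :: "'r signature \<Rightarrow> (nat \<Rightarrow> 'r struct pmf) \<Rightarrow> bool" where
  "random_structures \<sigma> D \<longleftrightarrow>
     (\<forall>n\<ge>1. \<forall>X\<in>set_pmf (D n). finite_structure \<sigma> X \<and> univ X = {1..n})"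

definition prob_models :: "'r struct pmf \<Rightarrow> 'r fo \<Rightarrow> real" where
  "prob_models P \<phi> = measure_pmf.prob P {X. X \<Turnstile> \<phi>}"

definition stochastic_fo_reduction ::
  "'r signature \<Rightarrow> (nat \<Rightarrow> 'r struct pmf) \<Rightarrow> 's signature \<Rightarrow> (nat \<Rightarrow> 's struct pmf) \<Rightarrow>
   ('r struct \<Rightarrow> 's struct) \<Rightarrow> bool" where
  "stochastic_fo_reduction \<sigma> D \<sigma>' D' f \<longleftrightarrow>
     random_structures \<sigma> D \<and> random_structures \<sigma>' D' \<and>
     (\<forall>X. finite_structure \<sigma> X \<longrightarrow> finite_structure \<sigma>' (f X) \<and> univ (f X) = univ X) \<and>
     (\<forall>\<phi>'. fo_sentence \<sigma>' \<phi>' \<longrightarrow>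
        (\<exists>\<phi>. fo_sentence \<sigma> \<phi> \<and>
             (\<forall>X. finite_structure \<sigma> X \<longrightarrow> (X \<Turnstile> \<phi> \<longleftrightarrow> f X \<Turnstile> \<phi>')) \<and>
             (\<lambda>n. \<bar>prob_models (D n) \<phi> - prob_models (D' n) \<phi>'\<bar>) \<longlonglongrightarrow> 0))"

text \<open>
  \<open>D' \<preceq> D\<close>; the map on structures goes from \<open>\<sigma>\<close>-structures, where \<open>D\<close> lives, to
  \<open>\<sigma>'\<close>-structures, where \<open>D'\<close> lives.
\<close>

definition fo_reducible ::
  "'s signature \<Rightarrow> (nat \<Rightarrow> 's struct pmf) \<Rightarrow> 'r signature \<Rightarrow> (nat \<Rightarrow> 'r struct pmf) \<Rightarrow> bool" where
  "fo_reducible \<sigma>' D' \<sigma> D \<longleftrightarrow> (\<exists>f. stochastic_fo_reduction \<sigma> D \<sigma>' D' f)"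

definition fo_zero_one_law :: "'r signature \<Rightarrow> (nat \<Rightarrow> 'r struct pmf) \<Rightarrow> bool" where
  "fo_zero_one_law \<sigma> D \<longleftrightarrow>
     (\<forall>\<phi>. fo_sentence \<sigma> \<phi> \<longrightarrow>
        (\<lambda>n. prob_models (D n) \<phi>) \<longlonglongrightarrow> 0 \<or> (\<lambda>n. prob_models (D n) \<phi>) \<longlonglongrightarrow> 1)"

text \<open>Tuples are lists, so the \<open>i\<close>-th entry of \<open>v\<close>, for \<open>i \<in> {1..d}\<close>, is \<open>v ! (i - 1)\<close>.\<close>

definition tuple_act :: "nat \<Rightarrow> (nat \<Rightarrow> nat) \<Rightarrow> 'a list \<Rightarrow> 'a list" where
  "tuple_act d g v = map (\<lambda>i. v ! ((inv\<^bsub>sym_group d\<^esub> g) i - 1)) [1..<Suc d]"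

definition distinct_tuples :: "nat \<Rightarrow> nat \<Rightarrow> nat list set" where
  "distinct_tuples n d = {v. length v = d \<and> distinct v \<and> set v \<subseteq> {1..n}}"

definition tuple_orbit :: "nat \<Rightarrow> (nat \<Rightarrow> nat) set \<Rightarrow> 'a list \<Rightarrow> 'a list set" where
  "tuple_orbit d H v = (\<lambda>g. tuple_act d g v) ` H"

definition hyperedges :: "nat \<Rightarrow> (nat \<Rightarrow> nat) set \<Rightarrow> nat \<Rightarrow> nat list set set" where
  "hyperedges d H n = tuple_orbit d H ` distinct_tuples n d"

definition hypergraph_sig :: "nat \<Rightarrow> unit signature" where
  "hypergraph_sig d = (\<lambda>_. d)"

definition binomial_hypergraph ::
  "nat \<Rightarrow> (nat \<Rightarrow> nat) set \<Rightarrow> nat \<Rightarrow> real \<Rightarrow> unit struct pmf" where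
  "binomial_hypergraph d H n p =
     map_pmf (\<lambda>\<omega>. Struct {1..n} (\<lambda>_. \<Union>{E \<in> hyperedges d H n. \<omega> E}))
       (Pi_pmf (hyperedges d H n) False (\<lambda>_. bernoulli_pmf p))"

definition subgroup_index :: "('a, 'b) monoid_scheme \<Rightarrow> 'a set \<Rightarrow> 'a set \<Rightarrow> nat" where
  "subgroup_index G H K = card (rcosets\<^bsub>G\<lparr>carrier := H\<rparr>\<^esub> K)"

end

theory Submission
  imports Defs "HOL-Real_Asymp.Real_Asymp"
begin

text \<open>
  Symmetrization keeps the tuples whose whole \<open>H\<close>-orbit lies in the relation. It is first-order
  definable, and since \<open>H\<close> acts freely on tuples of distinct elements, an \<open>H\<close>-orbit is the
  disjoint union of exactly \<open>[H:K]\<close> orbits of \<open>K\<close>; hence it maps \<open>G\<^sup>K(n,p)\<close> to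
  \<open>G\<^sup>H(n,p\<^bsup>[H:K]\<^esup>)\<close> exactly, not only asymptotically.

  For the 0--1 law take \<open>K\<close> trivial and the \<open>[H:K]\<close>-th root of the probability, so that all
  tuples of distinct elements are independent. A union bound shows that the extension axioms
  hold with probability tending to 1, and by a back-and-forth argument any two structures
  satisfying them agree on sentences of bounded quantifier rank.
\<close>

section \<open>Products of probability mass functions\<close>

text \<open>Functions of disjoint blocks of independent coordinates are independent; the last
  assumption says that \<open>g j\<close> reads only the coordinates in \<open>B j\<close>. The
  induction splits off one block with \<open>Pi_pmf_union\<close>: \<open>g x\<close> sees only the
  first factor, every other \<open>g j\<close> only the second.\<close>

lemma Pi_pmf_blocks:
  assumes "finite J" "finite I" "\<And>j. j \<in> J \<Longrightarrow> B j \<subseteq> I" "disjoint_family_on B J"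
    and "\<And>j \<omega> \<omega>'. j \<in> J \<Longrightarrow> (\<And>x. x \<in> B j \<Longrightarrow> \<omega> x = \<omega>' x) \<Longrightarrow> g j \<omega> = g j \<omega>'"
  shows "map_pmf (\<lambda>\<omega> j. if j \<in> J then g j \<omega> else e) (Pi_pmf I c p) =
         Pi_pmf J e (\<lambda>j. map_pmf (g j) (Pi_pmf (B j) c p))"
proof -
  have *: "map_pmf (\<lambda>\<omega> j. if j \<in> J then g j \<omega> else e) (Pi_pmf (\<Union>j\<in>J. B j) c p) =
         Pi_pmf J e (\<lambda>j. map_pmf (g j) (Pi_pmf (B j) c p))"
    using assms(1,3,4,5)
  proof (induction J rule: finite_induct)
    case empty
    then show ?case by simp
  next
    case (insert x J)
    let ?U = "\<Union>j\<in>J. B j"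
    have fin: "finite (B x)" "finite ?U"
      using insert.prems(1) insert.hyps(1) assms(2) by (auto intro: finite_subset)
    have disj: "B x \<inter> B j = {}" if "j \<in> J" for j
      using insert.prems(2) insert.hyps(2) that by (auto simp: disjoint_family_on_def)
    then have dj: "B x \<inter> ?U = {}" by blast
    have IH: "map_pmf (\<lambda>\<omega> j. if j \<in> J then g j \<omega> else e) (Pi_pmf ?U c p) =
         Pi_pmf J e (\<lambda>j. map_pmf (g j) (Pi_pmf (B j) c p))"
    proof (rule insert.IH)
      show "disjoint_family_on B J"
        using insert.prems(2) by (auto simp: disjoint_family_on_def)
    qed (use insert.prems(1) in blast, rule insert.prems(3), simp_all)
    have 1: "g x (\<lambda>y. if y \<in> B x then f y else h y) = g x f" for f h
      by (rule insert.prems(3)) auto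
    have 2: "g j (\<lambda>y. if y \<in> B x then f y else h y) = g j h" if "j \<in> J" for f h j
      using that disj[OF that] by (intro insert.prems(3)) auto
    have "map_pmf (\<lambda>\<omega> j. if j \<in> insert x J then g j \<omega> else e)
            (Pi_pmf (\<Union>j\<in>insert x J. B j) c p) =
          map_pmf ((\<lambda>(y, f). f(x := y)) \<circ> map_prod (g x) (\<lambda>\<omega> j. if j \<in> J then g j \<omega> else e))
            (pair_pmf (Pi_pmf (B x) c p) (Pi_pmf ?U c p))"
      unfolding UN_insert Pi_pmf_union[OF fin dj] map_pmf_comp
      using insert.hyps(2) by (intro map_pmf_cong refl) (auto simp: fun_eq_iff 1 2)
    also have "\<dots> = Pi_pmf (insert x J) e (\<lambda>j. map_pmf (g j) (Pi_pmf (B j) c p))"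
      using insert.hyps by (simp add: Pi_pmf_insert IH[symmetric] map_pair map_pmf_compose map_prod_def)
    finally show ?case .
  qed
  \<comment> \<open>The induction handles the union of the blocks; coordinates of \<open>I\<close>
    outside it are read by no \<open>g j\<close> and may be reset to the default
    \<open>c\<close>.\<close>
  have sub: "(\<Union>j\<in>J. B j) \<subseteq> I"
    using assms(3) by auto
  have "map_pmf (\<lambda>\<omega> j. if j \<in> J then g j \<omega> else e) (Pi_pmf (\<Union>j\<in>J. B j) c p) =
        map_pmf (\<lambda>\<omega> j. if j \<in> J then g j \<omega> else e) (Pi_pmf I c p)"
    by (subst Pi_pmf_subset[OF assms(2) sub])
       (auto simp: map_pmf_comp fun_eq_iff intro!: map_pmf_cong assms(5))
  with * show ?thesis by simp
qed

lemma bool_pmf_eq_bernoulli: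
  "M = bernoulli_pmf (pmf M True)"
proof (rule pmf_eqI)
  fix b show "pmf M b = pmf (bernoulli_pmf (pmf M True)) b"
    by (cases b) (auto simp: pmf_le_1 pmf_False_conv_True)
qed

lemma pmf_Pi_pattern:
  assumes "finite A"
  shows "pmf (map_pmf (\<lambda>\<omega>. \<forall>x\<in>A. \<omega> x = s x) (Pi_pmf A c p)) True = (\<Prod>x\<in>A. pmf (p x) (s x))"
proof -
  have "pmf (map_pmf (\<lambda>\<omega>. \<forall>x\<in>A. \<omega> x = s x) (Pi_pmf A c p)) True =
        measure_pmf.prob (Pi_pmf A c p) (Pi A (\<lambda>x. {s x}))"
    by (auto simp: pmf_map vimage_def Pi_def intro!: arg_cong2[where f = measure])
  also have "\<dots> = (\<Prod>x\<in>A. pmf (p x) (s x))"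
    using assms by (simp add: measure_Pi_pmf_Pi measure_pmf_single)
  finally show ?thesis .
qed

text \<open>Source of the exponent \<open>[H:K]\<close>: here \<open>A\<close> will be the set of
  \<open>K\<close>-orbits inside one \<open>H\<close>-orbit.\<close>

lemma map_pmf_All_bernoulli:
  assumes "finite A" "0 \<le> p" "p \<le> 1"
  shows "map_pmf (\<lambda>\<omega>. \<forall>x\<in>A. \<omega> x) (Pi_pmf A c (\<lambda>_. bernoulli_pmf p)) = bernoulli_pmf (p ^ card A)"
proof -
  have "pmf (map_pmf (\<lambda>\<omega>. \<forall>x\<in>A. \<omega> x) (Pi_pmf A c (\<lambda>_. bernoulli_pmf p))) True = p ^ card A"
    using pmf_Pi_pattern[OF assms(1), of "\<lambda>_. True" c "\<lambda>_. bernoulli_pmf p"] assms by simp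
  then show ?thesis
    by (metis bool_pmf_eq_bernoulli)
qed

text \<open>A single coordinate agrees with its prescribed value with probability at least
  \<open>min p (1 - p)\<close>, so a block of at most \<open>N\<close> coordinates matches with at
  least the \<open>N\<close>-th power of that, and disjoint blocks fail independently. Later each
  candidate witness of an extension axiom owns one block.\<close>

lemma prob_all_blocks_mismatch_le:
  fixes p :: real
  assumes "finite J" "finite I" "\<And>j. j \<in> J \<Longrightarrow> B j \<subseteq> I" "disjoint_family_on B J"
    and p: "0 < p" "p < 1" and N: "\<And>j. j \<in> J \<Longrightarrow> card (B j) \<le> N"
  shows "measure_pmf.prob (Pi_pmf I c (\<lambda>_. bernoulli_pmf p)) {\<omega>. \<forall>j\<in>J. \<exists>x\<in>B j. \<omega> x \<noteq> s j x}
         \<le> (1 - min p (1 - p) ^ N) ^ card J"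
proof -
  define g where "g j \<omega> \<longleftrightarrow> (\<forall>x\<in>B j. \<omega> x = s j x)" for j and \<omega> :: "'b \<Rightarrow> bool"
  define M where "M j = map_pmf (g j) (Pi_pmf (B j) c (\<lambda>_. bernoulli_pmf p))" for j
  have finB: "finite (B j)" if "j \<in> J" for j
    using assms(2,3) that finite_subset by blast
  have M: "min p (1 - p) ^ N \<le> pmf (M j) True" if j: "j \<in> J" for j
  proof -
    have "min p (1 - p) ^ N \<le> min p (1 - p) ^ card (B j)"
      using p N[OF j] by (intro power_decreasing) auto
    also have "\<dots> = (\<Prod>x\<in>B j. min p (1 - p))" by simp
    also have "\<dots> \<le> (\<Prod>x\<in>B j. pmf (bernoulli_pmf p) (s j x))"
    proof (rule prod_mono)
      fix x
      show "0 \<le> min p (1 - p) \<and> min p (1 - p) \<le> pmf (bernoulli_pmf p) (s j x)"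
        using p by (cases "s j x") auto
    qed
    also have "\<dots> = pmf (M j) True"
      unfolding M_def g_def[abs_def] by (rule pmf_Pi_pattern[OF finB[OF j], symmetric])
    finally show ?thesis .
  qed
  have blocks: "map_pmf (\<lambda>\<omega> j. if j \<in> J then g j \<omega> else False) (Pi_pmf I c (\<lambda>_. bernoulli_pmf p)) =
      Pi_pmf J False M"
    unfolding M_def using assms(1-4) by (intro Pi_pmf_blocks) (auto simp: g_def)
  \<comment> \<open>Once each block is collapsed to the truth value of its match, the event says
    that every coordinate of a product is \<open>False\<close>.\<close>
  have "measure_pmf.prob (Pi_pmf I c (\<lambda>_. bernoulli_pmf p)) {\<omega>. \<forall>j\<in>J. \<exists>x\<in>B j. \<omega> x \<noteq> s j x} =
      measure_pmf.prob (Pi_pmf J False M) (Pi J (\<lambda>_. {False}))"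
    by (subst blocks[symmetric]) (auto simp: g_def Pi_def intro!: arg_cong2[where f = measure])
  also have "\<dots> = (\<Prod>j\<in>J. 1 - pmf (M j) True)"
    using assms(1) by (simp add: measure_Pi_pmf_Pi measure_pmf_single pmf_False_conv_True)
  also have "\<dots> \<le> (\<Prod>j\<in>J. 1 - min p (1 - p) ^ N)"
    using M by (intro prod_mono) (auto simp: pmf_le_1)
  finally show ?thesis by simp
qed

section \<open>The action on tuples\<close>

lemma length_tuple_act [simp]: "length (tuple_act d g v) = d"
  by (simp add: tuple_act_def)

lemma sym_group_inv_eq:
  assumes "g permutes {1..d}"
  shows "inv\<^bsub>sym_group d\<^esub> g = inv' g"
proof (rule group.inv_equality[OF sym_group_is_group])
  show "inv' g \<otimes>\<^bsub>sym_group d\<^esub> g = \<one>\<^bsub>sym_group d\<^esub>"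
    using assms by (simp add: sym_group_mult sym_group_one permutes_inv_o)
qed (use assms in \<open>auto simp: sym_group_carrier permutes_inv\<close>)

text \<open>Shift between positions \<open>1..d\<close> and list indices: values of \<open>g\<close>
  on \<open>{1..d}\<close> are positive, so the subtraction does not truncate.\<close>

lemma permutes_index:
  assumes "g permutes {1..d}" "i < d"
  shows "g (Suc i) - 1 < d" "Suc (g (Suc i) - 1) = g (Suc i)"
  using permutes_in_image[OF assms(1), of "Suc i"] assms(2) by auto

lemma tuple_act_nth:
  assumes "g permutes {1..d}" "i < d"
  shows "tuple_act d g v ! i = v ! (inv' g (Suc i) - 1)"
  using assms by (simp add: tuple_act_def sym_group_inv_eq del: upt_Suc)

lemma tuple_act_id:
  assumes "length v = d"
  shows "tuple_act d id v = v"
  using assms by (intro nth_equalityI) (auto simp: tuple_act_nth permutes_id)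

text \<open>The inverse in the definition of the action makes it a left action, since inverting
  \<open>g \<circ> h\<close> reverses the order of the factors.\<close>

lemma tuple_act_comp:
  assumes g: "g permutes {1..d}" and h: "h permutes {1..d}"
  shows "tuple_act d g (tuple_act d h v) = tuple_act d (g \<circ> h) v"
proof (rule nth_equalityI)
  fix i assume "i < length (tuple_act d g (tuple_act d h v))"
  then have i: "i < d" by simp
  note ig = permutes_index[OF permutes_inv[OF g] i]
  have "inv' (g \<circ> h) = inv' h \<circ> inv' g"
    using g h by (simp add: o_inv_distrib permutes_bij)
  then show "tuple_act d g (tuple_act d h v) ! i = tuple_act d (g \<circ> h) v ! i"
    using i ig g h by (simp add: tuple_act_nth permutes_compose)
qed simp

lemma map_tuple_act:
  assumes "g permutes {1..d}" "length xs = d"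
  shows "map e (tuple_act d g xs) = tuple_act d g (map e xs)"
  using assms permutes_index[OF permutes_inv[OF assms(1)]]
  by (intro nth_equalityI) (auto simp: tuple_act_nth)

lemma set_tuple_act_subset:
  assumes "g permutes {1..d}" "length v = d"
  shows "set (tuple_act d g v) \<subseteq> set v"
  using assms permutes_index[OF permutes_inv[OF assms(1)]]
  by (auto simp: set_conv_nth tuple_act_nth)

lemma set_tuple_act:
  assumes "g permutes {1..d}" "length v = d"
  shows "set (tuple_act d g v) = set v"
proof
  have "tuple_act d (inv' g) (tuple_act d g v) = v"
    using assms by (simp add: tuple_act_comp permutes_inv permutes_inv_o tuple_act_id)
  then show "set v \<subseteq> set (tuple_act d g v)"
    using set_tuple_act_subset[OF permutes_inv[OF assms(1)], of "tuple_act d g v"] by simp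
qed (rule set_tuple_act_subset[OF assms])

lemma tuple_act_in_distinct_tuples:
  assumes "g permutes {1..d}" "v \<in> distinct_tuples n d"
  shows "tuple_act d g v \<in> distinct_tuples n d"
proof -
  have "set (tuple_act d g v) = set v"
    using assms by (intro set_tuple_act) (auto simp: distinct_tuples_def)
  then show ?thesis
    using assms(2) by (auto simp: distinct_tuples_def distinct_card intro!: card_distinct)
qed

text \<open>Freeness on tuples of distinct entries: entry \<open>k\<close> of the image shows which
  position of \<open>v\<close> it came from, and this determines the inverse permutation.\<close>

lemma tuple_act_inj:
  assumes g: "g permutes {1..d}" and h: "h permutes {1..d}"
    and v: "length v = d" "distinct v" and eq: "tuple_act d g v = tuple_act d h v"
  shows "g = h"
proof -
  have "inv' g i = inv' h i" for i
  proof (cases "i \<in> {1..d}")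
    case True
    then obtain k where k: "i = Suc k" "k < d"
      by (cases i) auto
    note kg = permutes_index[OF permutes_inv[OF g] k(2)]
    note kh = permutes_index[OF permutes_inv[OF h] k(2)]
    have "v ! (inv' g i - 1) = v ! (inv' h i - 1)"
      using arg_cong[OF eq, of "\<lambda>w. w ! k"] k g h by (simp add: tuple_act_nth)
    then show ?thesis
      using kg kh k v by (metis nth_eq_iff_index_eq)
  next
    case False
    then show ?thesis
      using permutes_inv[OF g] permutes_inv[OF h] by (metis permutes_not_in)
  qed
  then have "inv' g = inv' h" by auto
  then show ?thesis
    by (metis g h permutes_inv_inv)
qed

section \<open>Subgroups of the symmetric group, their orbits and hyperedges\<close>

lemma subgroup_sym_groupD:
  assumes "subgroup H (sym_group d)"
  shows "\<And>g. g \<in> H \<Longrightarrow> g permutes {1..d}" "id \<in> H"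
    "\<And>g h. g \<in> H \<Longrightarrow> h \<in> H \<Longrightarrow> g \<circ> h \<in> H" "\<And>g. g \<in> H \<Longrightarrow> inv' g \<in> H"
proof -
  interpret subgroup H "sym_group d" by (rule assms)
  show *: "g permutes {1..d}" if "g \<in> H" for g
    using mem_carrier[OF that] by (simp add: sym_group_carrier)
  show "id \<in> H"
    using one_closed by (simp add: sym_group_one)
  show "g \<circ> h \<in> H" if "g \<in> H" "h \<in> H" for g h
    using m_closed[OF that] by (simp add: sym_group_mult)
  show "inv' g \<in> H" if "g \<in> H" for g
    using m_inv_closed[OF that] *[OF that] by (simp add: sym_group_inv_eq)
qed

lemma finite_subgroup_sym_group:
  assumes "subgroup H (sym_group d)"
  shows "finite H"
  using subgroup_sym_groupD(1)[OF assms] finite_permutations[of "{1..d}"]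
  by (auto intro: finite_subset[of H "{g. g permutes {1..d}}"])

lemma finite_distinct_tuples: "finite (distinct_tuples n d)"
  by (rule finite_subset[OF _ finite_lists_length_eq[of "{1..n}" d]]) (auto simp: distinct_tuples_def)

lemma finite_hyperedges: "finite (hyperedges d H n)"
  by (simp add: hyperedges_def finite_distinct_tuples)

lemma mem_tuple_orbit_self:
  assumes "subgroup H (sym_group d)" "length v = d"
  shows "v \<in> tuple_orbit d H v"
  using subgroup_sym_groupD(2)[OF assms(1)] tuple_act_id[OF assms(2)]
  by (force simp: tuple_orbit_def)

lemma tuple_orbit_eq:
  assumes H: "subgroup H (sym_group d)" and v: "length v = d" and w: "w \<in> tuple_orbit d H v"
  shows "tuple_orbit d H w = tuple_orbit d H v"
proof -
  note HD = subgroup_sym_groupD[OF H]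
  have sub: "tuple_orbit d H w \<subseteq> tuple_orbit d H v" if "w \<in> tuple_orbit d H v" for v w :: "'a list"
    using that HD(1,3) by (auto simp: tuple_orbit_def tuple_act_comp)
  from w obtain h where h: "h \<in> H" "w = tuple_act d h v"
    by (auto simp: tuple_orbit_def)
  have "v = tuple_act d (inv' h) w"
    using h HD(1)[of h] v by (simp add: tuple_act_comp permutes_inv permutes_inv_o tuple_act_id)
  then have "v \<in> tuple_orbit d H w"
    using HD(4)[OF h(1)] by (auto simp: tuple_orbit_def)
  with sub w show ?thesis by blast
qed

lemma tuple_orbit_subset_distinct_tuples:
  assumes "subgroup H (sym_group d)" "v \<in> distinct_tuples n d"
  shows "tuple_orbit d H v \<subseteq> distinct_tuples n d"
  using assms subgroup_sym_groupD(1)[OF assms(1)]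
  by (auto simp: tuple_orbit_def intro: tuple_act_in_distinct_tuples)

text \<open>Orbits partition the tuples of distinct elements, so any member represents its
  hyperedge. This is the working description of hyperedges below.\<close>

lemma mem_hyperedge_iff:
  assumes H: "subgroup H (sym_group d)" and E: "E \<in> hyperedges d H n"
  shows "v \<in> E \<longleftrightarrow> v \<in> distinct_tuples n d \<and> E = tuple_orbit d H v"
proof -
  obtain u where u: "u \<in> distinct_tuples n d" "E = tuple_orbit d H u"
    using E by (auto simp: hyperedges_def)
  have len: "length w = d" if "w \<in> distinct_tuples n d" for w
    using that by (simp add: distinct_tuples_def)
  show ?thesis
    using u tuple_orbit_subset_distinct_tuples[OF H u(1)] tuple_orbit_eq[OF H len[OF u(1)]]
      mem_tuple_orbit_self[OF H len] by blast
qed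

text \<open>Fix \<open>v\<close> in \<open>E\<close>. By freeness, sending \<open>g\<close> to its
  action on \<open>v\<close> is a bijection from \<open>H\<close> onto \<open>E\<close>. It carries
  the coset of \<open>K\<close> through \<open>h\<close> to the \<open>K\<close>-orbit of the image
  of \<open>v\<close> under \<open>h\<close>, so cosets and suborbits are equinumerous.\<close>

lemma card_suborbits:
  assumes H: "subgroup H (sym_group d)" and K: "subgroup K ((sym_group d)\<lparr>carrier := H\<rparr>)"
    and E: "E \<in> hyperedges d H n"
  shows "card (tuple_orbit d K ` E) = subgroup_index (sym_group d) H K"
proof -
  have K': "subgroup K (sym_group d)"
    by (rule group.incl_subgroup[OF sym_group_is_group H K])
  note HD = subgroup_sym_groupD[OF H] and KD = subgroup_sym_groupD[OF K']
  have KH: "K \<subseteq> H"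
    using subgroup.subset[OF K] by simp
  obtain v where v: "v \<in> distinct_tuples n d" "E = tuple_orbit d H v"
    using E by (auto simp: hyperedges_def)
  then have dv: "length v = d" "distinct v" by (auto simp: distinct_tuples_def)
  define F where "F C = (\<lambda>g. tuple_act d g v) ` C" for C
  have cosets: "rcosets\<^bsub>(sym_group d)\<lparr>carrier := H\<rparr>\<^esub> K = (\<lambda>h. (\<lambda>k. k \<circ> h) ` K) ` H"
    by (auto simp: RCOSETS_def r_coset_def sym_group_mult)
  have orb: "tuple_orbit d K (tuple_act d h v) = F ((\<lambda>k. k \<circ> h) ` K)" if "h \<in> H" for h
    using that HD(1) KD(1) by (auto simp: F_def tuple_orbit_def tuple_act_comp image_image)
  have "tuple_orbit d K ` E = F ` (rcosets\<^bsub>(sym_group d)\<lparr>carrier := H\<rparr>\<^esub> K)"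
    unfolding cosets v(2) tuple_orbit_def[of d H] image_image using orb by (auto simp: image_iff)
  \<comment> \<open>\<open>F\<close> takes images under a map injective on \<open>H\<close>, hence
    separates all subsets of \<open>H\<close>, in particular the cosets.\<close>
  moreover have "inj_on F (Pow H)"
  proof -
    have "inj_on (\<lambda>g. tuple_act d g v) H"
      using HD(1) dv by (auto intro!: inj_onI tuple_act_inj)
    then show ?thesis
      unfolding F_def by (rule inj_on_image_Pow)
  qed
  moreover have "rcosets\<^bsub>(sym_group d)\<lparr>carrier := H\<rparr>\<^esub> K \<subseteq> Pow H"
    unfolding cosets using HD(3) KH by auto
  ultimately show ?thesis
    unfolding subgroup_index_def by (metis card_image inj_on_subset)
qed

section \<open>The reduction\<close>

text \<open>\<open>tuple_act d h v\<close> has length \<open>d\<close> for every list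
  \<open>v\<close>, so the arity of \<open>v\<close> itself has to be demanded separately.\<close>

definition symmetrize :: "nat \<Rightarrow> (nat \<Rightarrow> nat) set \<Rightarrow> unit struct \<Rightarrow> unit struct" where
  "symmetrize d H X = Struct (univ X) (\<lambda>_. {v. length v = d \<and> (\<forall>h\<in>H. tuple_act d h v \<in> rel X ())})"

text \<open>The group is listed as \<open>hs\<close> so that a finite conjunction over it can be
  written. The syntax has no truth constant; the fold starts from the atom itself, which is the
  conjunct of the identity.\<close>

primrec pullback :: "nat \<Rightarrow> (nat \<Rightarrow> nat) list \<Rightarrow> unit fo \<Rightarrow> unit fo" where
  "pullback d hs (Equal x y) = Equal x y"
| "pullback d hs (Atom r xs) = foldr (\<lambda>h. Conj (Atom r (tuple_act d h xs))) hs (Atom r xs)"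
| "pullback d hs (Neg \<phi>) = Neg (pullback d hs \<phi>)"
| "pullback d hs (Conj \<phi> \<psi>) = Conj (pullback d hs \<phi>) (pullback d hs \<psi>)"
| "pullback d hs (Exists x \<phi>) = Exists x (pullback d hs \<phi>)"

lemma fo_wf_pullback:
  assumes "fo_wf (hypergraph_sig d) \<phi>"
  shows "fo_wf (hypergraph_sig d) (pullback d hs \<phi>)"
  using assms
proof (induction \<phi>)
  case (Atom r xs)
  then show ?case
    by (induction hs) (auto simp: hypergraph_sig_def)
qed auto

lemma free_vars_pullback:
  assumes "fo_wf (hypergraph_sig d) \<phi>" "\<And>h. h \<in> set hs \<Longrightarrow> h permutes {1..d}"
  shows "free_vars (pullback d hs \<phi>) = free_vars \<phi>"
  using assms
proof (induction \<phi>)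
  case (Atom r xs)
  then show ?case
    by (induction hs) (auto simp: hypergraph_sig_def set_tuple_act)
qed auto

text \<open>Symmetrization keeps the universe, so connectives and quantifiers commute with it and
  only atoms need an argument: evaluating variables commutes with permuting positions
  (\<open>map_tuple_act\<close>), and the seed of the fold is covered by \<open>id\<close>.\<close>

lemma sat_pullback:
  assumes "fo_wf (hypergraph_sig d) \<phi>" "\<And>h. h \<in> set hs \<Longrightarrow> h permutes {1..d}" "id \<in> set hs"
  shows "sat X e (pullback d hs \<phi>) \<longleftrightarrow> sat (symmetrize d (set hs) X) e \<phi>"
  using assms(1)
proof (induction \<phi> arbitrary: e)
  case (Atom r xs)
  then have len: "length xs = d" by (simp add: hypergraph_sig_def)
  have "sat X e (foldr (\<lambda>h. Conj (Atom r (tuple_act d h xs))) gs (Atom r xs)) \<longleftrightarrow>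
      map e xs \<in> rel X () \<and> (\<forall>h\<in>set gs. map e (tuple_act d h xs) \<in> rel X ())" for gs
    by (induction gs) auto
  then show ?case
    using assms(2,3) len tuple_act_id[of "map e xs" d]
    by (auto simp: symmetrize_def map_tuple_act)
qed (auto simp: symmetrize_def)

lemma finite_structure_symmetrize:
  assumes "finite_structure (hypergraph_sig d) X" "id \<in> H"
  shows "finite_structure (hypergraph_sig d) (symmetrize d H X)"
proof -
  have "v \<in> rel X ()" if "length v = d" "\<forall>h\<in>H. tuple_act d h v \<in> rel X ()" for v
    using that assms(2) tuple_act_id[OF that(1)] by metis
  then show ?thesis
    using assms(1) by (auto simp: finite_structure_def symmetrize_def hypergraph_sig_def)
qed

lemma random_structures_binomial_hypergraph:
  assumes "subgroup H (sym_group d)"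
  shows "random_structures (hypergraph_sig d) (\<lambda>n. binomial_hypergraph d H n (p n))"
proof -
  have "length v = d \<and> set v \<subseteq> {1..n}" if "E \<in> hyperedges d H n" "v \<in> E" for E v n
    using mem_hyperedge_iff[OF assms that(1)] that(2) by (auto simp: distinct_tuples_def)
  then have "rel X r \<subseteq> {v. length v = d \<and> set v \<subseteq> {1..n}} \<and> univ X = {1..n}"
    if "X \<in> set_pmf (binomial_hypergraph d H n (p n))" for X r n
    using that by (fastforce simp: binomial_hypergraph_def)
  then show ?thesis
    by (simp add: random_structures_def finite_structure_def hypergraph_sig_def)
qed

text \<open>An \<open>H\<close>-hyperedge survives exactly when all \<open>K\<close>-orbits inside
  it are present. These \<open>K\<close>-orbits form disjoint blocks \<open>B E\<close> of size
  \<open>[H:K]\<close>, so \<open>Pi_pmf_blocks\<close> yields independent Bernoulli variables with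
  the powered probability.\<close>

lemma symmetrize_binomial_hypergraph:
  assumes H: "subgroup H (sym_group d)" and K: "subgroup K ((sym_group d)\<lparr>carrier := H\<rparr>)"
    and p: "0 \<le> p" "p \<le> 1"
  shows "map_pmf (symmetrize d H) (binomial_hypergraph d K n p) =
         binomial_hypergraph d H n (p ^ subgroup_index (sym_group d) H K)"
proof -
  have K': "subgroup K (sym_group d)"
    by (rule group.incl_subgroup[OF sym_group_is_group H K])
  note HD = subgroup_sym_groupD[OF H]
  have KH: "K \<subseteq> H"
    using subgroup.subset[OF K] by simp
  let ?I = "hyperedges d K n" and ?J = "hyperedges d H n"
  define B where "B E = tuple_orbit d K ` E" for E :: "nat list set"
  define g where "g E \<omega> \<longleftrightarrow> (\<forall>E'\<in>B E. \<omega> E')" for E and \<omega> :: "nat list set \<Rightarrow> bool"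
  have BI: "B E \<subseteq> ?I" if "E \<in> ?J" for E
    using that mem_hyperedge_iff[OF H that] by (auto simp: B_def hyperedges_def)
  \<comment> \<open>A \<open>K\<close>-orbit shared by two blocks would put one tuple into both
    \<open>H\<close>-orbits, because \<open>K\<close> is contained in \<open>H\<close>.\<close>
  have disj: "disjoint_family_on B ?J"
  proof -
    have "E = F" if E: "E \<in> ?J" and F: "F \<in> ?J" and meet: "B E \<inter> B F \<noteq> {}" for E F
    proof -
      obtain v w where v: "v \<in> E" and w: "w \<in> F" and eq: "tuple_orbit d K v = tuple_orbit d K w"
        using meet by (auto simp: B_def)
      have v': "v \<in> distinct_tuples n d" "E = tuple_orbit d H v"
        and w': "w \<in> distinct_tuples n d" "F = tuple_orbit d H w"
        using v w mem_hyperedge_iff[OF H E] mem_hyperedge_iff[OF H F] by auto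
      have "v \<in> tuple_orbit d K w"
        using mem_tuple_orbit_self[OF K', of v] v' eq by (simp add: distinct_tuples_def)
      then have "v \<in> F"
        using KH w' by (auto simp: tuple_orbit_def)
      then show ?thesis
        using v' mem_hyperedge_iff[OF H F] by auto
    qed
    then show ?thesis
      by (auto simp: disjoint_family_on_def)
  qed
  have "Pi_pmf ?J False (\<lambda>E. map_pmf (g E) (Pi_pmf (B E) False (\<lambda>_. bernoulli_pmf p))) =
        Pi_pmf ?J False (\<lambda>_. bernoulli_pmf (p ^ subgroup_index (sym_group d) H K))"
  proof (rule Pi_pmf_cong)
    fix E assume E: "E \<in> ?J"
    then have "finite (B E)"
      using BI finite_hyperedges finite_subset by blast
    then show "map_pmf (g E) (Pi_pmf (B E) False (\<lambda>_. bernoulli_pmf p)) =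
        bernoulli_pmf (p ^ subgroup_index (sym_group d) H K)"
      using map_pmf_All_bernoulli[of "B E" p False] p
      by (simp add: g_def[abs_def] card_suborbits[OF H K E, folded B_def])
  qed auto
  also have "Pi_pmf ?J False (\<lambda>E. map_pmf (g E) (Pi_pmf (B E) False (\<lambda>_. bernoulli_pmf p))) =
      map_pmf (\<lambda>\<omega> E. if E \<in> ?J then g E \<omega> else False) (Pi_pmf ?I False (\<lambda>_. bernoulli_pmf p))"
    using BI disj by (intro Pi_pmf_blocks[symmetric]) (auto simp: finite_hyperedges g_def)
  finally have blocks: "map_pmf (\<lambda>\<omega> E. if E \<in> ?J then g E \<omega> else False)
      (Pi_pmf ?I False (\<lambda>_. bernoulli_pmf p)) =
      Pi_pmf ?J False (\<lambda>_. bernoulli_pmf (p ^ subgroup_index (sym_group d) H K))" .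
  \<comment> \<open>For each fixed outcome \<open>\<omega>\<close> of the \<open>K\<close>-orbits,
    the symmetrized relation is the union of the \<open>H\<close>-orbits whose blocks are entirely
    present.\<close>
  have rel_eq: "{v. length v = d \<and> (\<forall>h\<in>H. tuple_act d h v \<in> \<Union>{E \<in> ?I. \<omega> E})} =
      \<Union>{E \<in> ?J. g E \<omega>}" for \<omega>
  proof (intro equalityI subsetI)
    fix v assume "v \<in> {v. length v = d \<and> (\<forall>h\<in>H. tuple_act d h v \<in> \<Union>{E \<in> ?I. \<omega> E})}"
    then have len: "length v = d"
      and *: "\<And>h. h \<in> H \<Longrightarrow> tuple_act d h v \<in> distinct_tuples n d \<and> \<omega> (tuple_orbit d K (tuple_act d h v))"
      using mem_hyperedge_iff[OF K'] by auto
    have v: "v \<in> distinct_tuples n d"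
      using *[OF HD(2)] tuple_act_id[OF len] by simp
    have "g (tuple_orbit d H v) \<omega>"
      using * by (auto simp: g_def B_def tuple_orbit_def[of d H])
    then show "v \<in> \<Union>{E \<in> ?J. g E \<omega>}"
      using v mem_tuple_orbit_self[OF H len] by (auto simp: hyperedges_def)
  next
    fix v assume "v \<in> \<Union>{E \<in> ?J. g E \<omega>}"
    then have v: "v \<in> distinct_tuples n d" and g: "g (tuple_orbit d H v) \<omega>"
      using mem_hyperedge_iff[OF H] by auto
    have "tuple_act d h v \<in> \<Union>{E \<in> ?I. \<omega> E}" if h: "h \<in> H" for h
    proof -
      have "\<omega> (tuple_orbit d K (tuple_act d h v))"
        using g h by (auto simp: g_def B_def tuple_orbit_def[of d H])
      moreover have "tuple_act d h v \<in> distinct_tuples n d"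
        using tuple_act_in_distinct_tuples HD(1) h v by blast
      ultimately show ?thesis
        using mem_tuple_orbit_self[OF K', of "tuple_act d h v"] by (auto simp: hyperedges_def)
    qed
    then show "v \<in> {v. length v = d \<and> (\<forall>h\<in>H. tuple_act d h v \<in> \<Union>{E \<in> ?I. \<omega> E})}"
      using v by (auto simp: distinct_tuples_def)
  qed
  show ?thesis
    unfolding binomial_hypergraph_def blocks[symmetric] map_pmf_comp
    by (intro map_pmf_cong refl) (simp add: symmetrize_def rel_eq del: Union_iff cong: conj_cong)
qed

lemma binomial_hypergraph_pullback:
  assumes H: "subgroup H (sym_group d)" and K: "subgroup K ((sym_group d)\<lparr>carrier := H\<rparr>)"
    and p: "0 \<le> p" "p \<le> 1"
    and \<phi>: "fo_wf (hypergraph_sig d) \<phi>" and hs: "set hs = H"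
  shows "prob_models (binomial_hypergraph d K n p) (pullback d hs \<phi>) =
         prob_models (binomial_hypergraph d H n (p ^ subgroup_index (sym_group d) H K)) \<phi>"
proof -
  have "X \<Turnstile> pullback d hs \<phi> \<longleftrightarrow> symmetrize d H X \<Turnstile> \<phi>" for X
    using sat_pullback[OF \<phi>, of hs] subgroup_sym_groupD[OF H] hs by (simp add: models_def)
  then show ?thesis
    by (simp add: prob_models_def symmetrize_binomial_hypergraph[OF H K p, symmetric] vimage_def)
qed

lemma fo_reducible_binomial_hypergraph:
  assumes H: "subgroup H (sym_group d)" and K: "subgroup K ((sym_group d)\<lparr>carrier := H\<rparr>)"
    and p: "\<And>n. 0 \<le> p n \<and> p n \<le> 1"
  shows "fo_reducible
           (hypergraph_sig d) (\<lambda>n. binomial_hypergraph d H n (p n ^ subgroup_index (sym_group d) H K))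
           (hypergraph_sig d) (\<lambda>n. binomial_hypergraph d K n (p n))"
proof -
  have K': "subgroup K (sym_group d)"
    by (rule group.incl_subgroup[OF sym_group_is_group H K])
  note HD = subgroup_sym_groupD[OF H]
  obtain hs where hs: "set hs = H"
    using finite_list[OF finite_subgroup_sym_group[OF H]] by blast
  have "stochastic_fo_reduction (hypergraph_sig d) (\<lambda>n. binomial_hypergraph d K n (p n))
      (hypergraph_sig d) (\<lambda>n. binomial_hypergraph d H n (p n ^ subgroup_index (sym_group d) H K))
      (symmetrize d H)"
    unfolding stochastic_fo_reduction_def
  proof (intro conjI allI impI)
    fix \<phi> assume "fo_sentence (hypergraph_sig d) \<phi>"
    then have wf: "fo_wf (hypergraph_sig d) \<phi>" and fv: "free_vars \<phi> = {}"
      by (auto simp: fo_sentence_def)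
    have "fo_sentence (hypergraph_sig d) (pullback d hs \<phi>)"
      using fo_wf_pullback[OF wf] free_vars_pullback[OF wf, of hs] hs HD(1) fv
      by (simp add: fo_sentence_def)
    moreover have "X \<Turnstile> pullback d hs \<phi> \<longleftrightarrow> symmetrize d H X \<Turnstile> \<phi>" for X
      using sat_pullback[OF wf, of hs] HD hs by (simp add: models_def)
    \<comment> \<open>The difference is zero for every \<open>n\<close>, not only in the
      limit.\<close>
    moreover have "(\<lambda>n. \<bar>prob_models (binomial_hypergraph d K n (p n)) (pullback d hs \<phi>) -
        prob_models (binomial_hypergraph d H n (p n ^ subgroup_index (sym_group d) H K)) \<phi>\<bar>)
        \<longlonglongrightarrow> 0"
      using binomial_hypergraph_pullback[OF H K _ _ wf hs] p by simp
    ultimately show "\<exists>\<psi>. fo_sentence (hypergraph_sig d) \<psi> \<and>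
        (\<forall>X. finite_structure (hypergraph_sig d) X \<longrightarrow> (X \<Turnstile> \<psi> \<longleftrightarrow> symmetrize d H X \<Turnstile> \<phi>)) \<and>
        (\<lambda>n. \<bar>prob_models (binomial_hypergraph d K n (p n)) \<psi> -
          prob_models (binomial_hypergraph d H n (p n ^ subgroup_index (sym_group d) H K)) \<phi>\<bar>)
        \<longlonglongrightarrow> 0"
      by blast
  next
    fix X assume "finite_structure (hypergraph_sig d) X"
    then show "finite_structure (hypergraph_sig d) (symmetrize d H X)"
      using finite_structure_symmetrize HD(2) by blast
    show "univ (symmetrize d H X) = univ X"
      by (simp add: symmetrize_def)
  qed (simp_all add: random_structures_binomial_hypergraph[OF H] random_structures_binomial_hypergraph[OF K'])
  then show ?thesis
    unfolding fo_reducible_def by blast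
qed

lemma fo_zero_one_law_reducible:
  assumes "fo_reducible \<sigma>' D' \<sigma> D" "fo_zero_one_law \<sigma> D"
  shows "fo_zero_one_law \<sigma>' D'"
  unfolding fo_zero_one_law_def
proof (intro allI impI)
  fix \<phi>' assume "fo_sentence \<sigma>' \<phi>'"
  then obtain \<phi> where \<phi>: "fo_sentence \<sigma> \<phi>"
      "(\<lambda>n. \<bar>prob_models (D n) \<phi> - prob_models (D' n) \<phi>'\<bar>) \<longlonglongrightarrow> 0"
    using assms(1) unfolding fo_reducible_def stochastic_fo_reduction_def by blast
  have diff: "(\<lambda>n. prob_models (D n) \<phi> - prob_models (D' n) \<phi>') \<longlonglongrightarrow> 0"
    using \<phi>(2) by (rule tendsto_rabs_zero_cancel)
  have lim: "(\<lambda>n. prob_models (D' n) \<phi>') \<longlonglongrightarrow> c" if "(\<lambda>n. prob_models (D n) \<phi>) \<longlonglongrightarrow> c" for c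
    using tendsto_diff[OF that diff] by simp
  show "(\<lambda>n. prob_models (D' n) \<phi>') \<longlonglongrightarrow> 0 \<or> (\<lambda>n. prob_models (D' n) \<phi>') \<longlonglongrightarrow> 1"
    using lim assms(2) \<phi>(1) unfolding fo_zero_one_law_def by blast
qed

section \<open>Extension axioms\<close>

text \<open>In a template the entry \<open>0\<close> is a placeholder for a new vertex; vertices are positive.\<close>

definition templates :: "nat \<Rightarrow> nat set \<Rightarrow> nat list set" where
  "templates d A = {v. length v = d \<and> distinct v \<and> set v \<subseteq> insert 0 A \<and> 0 \<in> set v}"

text \<open>The extension axioms for at most \<open>k\<close> old vertices: \<open>S\<close>
  prescribes which tuples through the new vertex \<open>b\<close> are related, and
  \<open>id(0 := b)\<close> puts \<open>b\<close> in place of the placeholder.\<close>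

definition extension_property :: "nat \<Rightarrow> nat \<Rightarrow> unit struct \<Rightarrow> bool" where
  "extension_property d k X \<longleftrightarrow>
     (\<forall>A S. A \<subseteq> univ X \<and> card A \<le> k \<longrightarrow>
        (\<exists>b\<in>univ X - A. \<forall>v\<in>templates d A. map (id(0 := b)) v \<in> rel X () \<longleftrightarrow> v \<in> S))"

text \<open>The sure properties of the samples on which back-and-forth relies: \<open>0\<close>
  stays free as a placeholder, and all related tuples through a new vertex come from
  templates.\<close>

definition distinct_structure :: "nat \<Rightarrow> unit struct \<Rightarrow> bool" where
  "distinct_structure d X \<longleftrightarrow>
     0 \<notin> univ X \<and> rel X () \<subseteq> {v. length v = d \<and> distinct v \<and> set v \<subseteq> univ X}"

text \<open>Equality of atomic types: sending \<open>e x\<close> to \<open>f x\<close> is a partial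
  isomorphism between the images of \<open>W\<close>.\<close>

definition same_type :: "nat set \<Rightarrow> unit struct \<Rightarrow> (nat \<Rightarrow> nat) \<Rightarrow> unit struct \<Rightarrow> (nat \<Rightarrow> nat) \<Rightarrow> bool"
  where
  "same_type W X e Y f \<longleftrightarrow>
     e ` W \<subseteq> univ X \<and> f ` W \<subseteq> univ Y \<and>
     (\<forall>x\<in>W. \<forall>y\<in>W. e x = e y \<longleftrightarrow> f x = f y) \<and>
     (\<forall>xs. set xs \<subseteq> W \<longrightarrow> (map e xs \<in> rel X () \<longleftrightarrow> map f xs \<in> rel Y ()))"

lemma same_type_sym: "same_type W X e Y f \<Longrightarrow> same_type W Y f X e"
  by (auto simp: same_type_def)

lemma same_type_subset: "same_type W X e Y f \<Longrightarrow> V \<subseteq> W \<Longrightarrow> same_type V X e Y f"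
  unfolding same_type_def by (meson image_mono subset_eq)

lemma distinct_map_cong:
  assumes "\<And>y z. y \<in> set xs \<Longrightarrow> z \<in> set xs \<Longrightarrow> f y = f z \<longleftrightarrow> g y = g z"
  shows "distinct (map f xs) \<longleftrightarrow> distinct (map g xs)"
  using assms by (auto simp: distinct_map inj_on_def)

text \<open>The forth step of back-and-forth. If \<open>a\<close> is already a value of
  \<open>e\<close> on \<open>W\<close>, the matching value of \<open>f\<close> answers it. Otherwise
  the type of \<open>a\<close> over the old vertices is translated into a prescription on templates,
  which the extension property of \<open>Y\<close> realizes by a fresh \<open>b\<close>.\<close>

lemma same_type_extend:
  assumes t: "same_type W X e Y f" and x: "x \<notin> W" and W: "finite W" "card W \<le> k"
    and X: "distinct_structure d X" and Y: "distinct_structure d Y" "extension_property d k Y"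
    and a: "a \<in> univ X"
  shows "\<exists>b\<in>univ Y. same_type (insert x W) X (e(x := a)) Y (f(x := b))"
proof (cases "a \<in> e ` W")
  case True
  then obtain w where w: "w \<in> W" "a = e w" by auto
  \<comment> \<open>Substituting \<open>w\<close> for the variable \<open>x\<close> reduces tuples
    over \<open>insert x W\<close> to tuples over \<open>W\<close>, where the types agree
    already.\<close>
  have eq: "e' \<in> {e, f} \<Longrightarrow> map (e'(x := e' w)) xs = map e' (map (id(x := w)) xs)" for e' xs
    by auto
  have "map (e(x := e w)) xs \<in> rel X () \<longleftrightarrow> map (f(x := f w)) xs \<in> rel Y ()"
    if "set xs \<subseteq> insert x W" for xs
  proof -
    have "set (map (id(x := w)) xs) \<subseteq> W"
      using that w(1) by auto
    then show ?thesis
      using t eq[of e xs] eq[of f xs] unfolding same_type_def by (metis insertCI)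
  qed
  then have "same_type (insert x W) X (e(x := e w)) Y (f(x := f w))"
    using t w x unfolding same_type_def by (auto simp: image_subset_iff)
  then show ?thesis
    using t w unfolding same_type_def by blast
next
  case False
  \<comment> \<open>The related tuples of \<open>X\<close> are transported to templates over the
    image of \<open>W\<close> under \<open>f\<close>, with the placeholder at the positions of
    \<open>a\<close>.\<close>
  define S where "S = {map (f(x := 0)) xs | xs. set xs \<subseteq> insert x W \<and> map (e(x := a)) xs \<in> rel X ()}"
  have fW: "f ` W \<subseteq> univ Y" "card (f ` W) \<le> k"
    using t W card_image_le[OF W(1), of f] by (auto simp: same_type_def)
  then obtain b where b: "b \<in> univ Y" "b \<notin> f ` W"
    and S: "\<And>v. v \<in> templates d (f ` W) \<Longrightarrow> map (id(0 := b)) v \<in> rel Y () \<longleftrightarrow> v \<in> S"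
    using Y(2)[unfolded extension_property_def, rule_format, of "f ` W" S] by blast
  have "0 \<notin> univ Y"
    using Y(1) by (simp add: distinct_structure_def)
  then have f0: "f y \<noteq> 0" if "y \<in> W" for y
    using fW(1) that by (metis image_subset_iff)
  have fb: "f y \<noteq> b" and ea: "e y \<noteq> a" if "y \<in> W" for y
    using that b(2) False by auto
  have W_eq: "\<forall>y\<in>W. \<forall>z\<in>W. e y = e z \<longleftrightarrow> f y = f z"
    using t by (simp add: same_type_def)
  \<comment> \<open>The values \<open>a\<close>, \<open>b\<close> and \<open>0\<close> are all
    fresh, so the three extended assignments have the same equality pattern.\<close>
  have eqf: "(f(x := b)) y = (f(x := b)) z \<longleftrightarrow> (e(x := a)) y = (e(x := a)) z"
    and eq0: "(f(x := 0)) y = (f(x := 0)) z \<longleftrightarrow> (e(x := a)) y = (e(x := a)) z"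
    if "y \<in> insert x W" "z \<in> insert x W" for y z
    using that W_eq by (auto simp: f0 fb ea fb[symmetric] ea[symmetric])
  have "map (e(x := a)) xs \<in> rel X () \<longleftrightarrow> map (f(x := b)) xs \<in> rel Y ()"
    if xs: "set xs \<subseteq> insert x W" for xs
  proof (cases "x \<in> set xs")
    case False
    then have "map (e(x := a)) xs = map e xs" "map (f(x := b)) xs = map f xs" "set xs \<subseteq> W"
      using xs by auto
    then show ?thesis
      using t unfolding same_type_def by metis
  next
    case True
    have distb: "distinct (map (f(x := b)) xs) \<longleftrightarrow> distinct (map (e(x := a)) xs)"
      by (rule distinct_map_cong) (use eqf xs in blast)
    have dist0: "distinct (map (f(x := 0)) xs) \<longleftrightarrow> distinct (map (e(x := a)) xs)"
      by (rule distinct_map_cong) (use eq0 xs in blast)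
    show ?thesis
    proof (cases "length xs = d \<and> distinct (map (e(x := a)) xs)")
      \<comment> \<open>A tuple of wrong length or with a repeated entry lies in neither relation;
        by \<open>distb\<close> repetitions occur on both sides together.\<close>
      case False
      then show ?thesis
        using X Y(1) distb unfolding distinct_structure_def
        by (metis (mono_tags, lifting) length_map mem_Collect_eq subsetD)
    next
      case d: True
      let ?v = "map (f(x := 0)) xs"
      have "?v \<in> templates d (f ` W)"
        using d dist0 xs True by (auto simp: templates_def)
      moreover have "map (id(0 := b)) ?v = map (f(x := b)) xs"
        by (auto dest!: subsetD[OF xs] f0)
      moreover have "?v \<in> S \<longleftrightarrow> map (e(x := a)) xs \<in> rel X ()"
      proof
        \<comment> \<open>Membership in \<open>S\<close> only provides some variable list
          \<open>ys\<close> with the same template; by \<open>eq0\<close> it has the same values as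
          \<open>xs\<close> under \<open>e(x := a)\<close>.\<close>
        assume "?v \<in> S"
        then obtain ys where ys: "?v = map (f(x := 0)) ys" "set ys \<subseteq> insert x W"
            "map (e(x := a)) ys \<in> rel X ()"
          by (auto simp: S_def)
        have len: "length xs = length ys"
          using ys(1) by (rule map_eq_imp_length_eq)
        have "map (e(x := a)) xs = map (e(x := a)) ys"
        proof (rule nth_equalityI)
          fix i assume "i < length (map (e(x := a)) xs)"
          then have i: "i < length xs" "i < length ys" using len by auto
          have "(f(x := 0)) (xs ! i) = (f(x := 0)) (ys ! i)"
            using arg_cong[OF ys(1), of "\<lambda>l. l ! i"] i by simp
          then have "(e(x := a)) (xs ! i) = (e(x := a)) (ys ! i)"
            using eq0[of "xs ! i" "ys ! i"] xs ys(2) i nth_mem by blast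
          then show "map (e(x := a)) xs ! i = map (e(x := a)) ys ! i"
            using i by simp
        qed (simp add: len)
        then show "map (e(x := a)) xs \<in> rel X ()"
          using ys(3) by simp
      qed (use xs in \<open>auto simp: S_def\<close>)
      ultimately show ?thesis
        using S by metis
    qed
  qed
  then have "same_type (insert x W) X (e(x := a)) Y (f(x := b))"
    using t x a b(1) eqf unfolding same_type_def by (auto simp: image_subset_iff)
  then show ?thesis
    using b(1) by blast
qed

section \<open>Back-and-forth: the extension property decides sentences of bounded quantifier
  rank\<close>

primrec quantifier_rank :: "'r fo \<Rightarrow> nat" where
  "quantifier_rank (Equal x y) = 0"
| "quantifier_rank (Atom r xs) = 0"
| "quantifier_rank (Neg \<phi>) = quantifier_rank \<phi>"
| "quantifier_rank (Conj \<phi> \<psi>) = max (quantifier_rank \<phi>) (quantifier_rank \<psi>)"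
| "quantifier_rank (Exists x \<phi>) = Suc (quantifier_rank \<phi>)"

lemma finite_free_vars: "finite (free_vars \<phi>)"
  by (induction \<phi>) auto

text \<open>Free variables plus quantifier rank serve as the budget: removing a quantifier lowers
  the rank by one and frees at most one variable, so the bound \<open>k\<close> persists and
  \<open>same_type_extend\<close> stays applicable. Symmetry of \<open>same_type\<close> gives the
  back direction.\<close>

lemma sat_same_type:
  assumes "distinct_structure d X" "extension_property d k X"
    and "distinct_structure d Y" "extension_property d k Y"
    and "card (free_vars \<phi>) + quantifier_rank \<phi> \<le> k"
    and "same_type (free_vars \<phi>) X e Y f"
  shows "sat X e \<phi> \<longleftrightarrow> sat Y f \<phi>"
  using assms(5,6)
proof (induction \<phi> arbitrary: e f)
  case (Equal x y)
  then show ?case by (auto simp: same_type_def)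
next
  case (Atom r xs)
  then show ?case by (auto simp: same_type_def)
next
  case (Neg \<phi>)
  then show ?case by auto
next
  case (Conj \<phi> \<psi>)
  have fv: "free_vars \<phi> \<subseteq> free_vars (Conj \<phi> \<psi>)" "free_vars \<psi> \<subseteq> free_vars (Conj \<phi> \<psi>)"
    by auto
  then have "card (free_vars \<phi>) \<le> card (free_vars (Conj \<phi> \<psi>))"
      "card (free_vars \<psi>) \<le> card (free_vars (Conj \<phi> \<psi>))"
    by (meson card_mono finite_free_vars)+
  then have "sat X e \<phi> \<longleftrightarrow> sat Y f \<phi>" "sat X e \<psi> \<longleftrightarrow> sat Y f \<psi>"
    using Conj.prems(1)
    by (auto intro!: Conj.IH same_type_subset[OF Conj.prems(2)])
  then show ?case by simp
next
  case (Exists x \<phi>)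
  let ?W = "free_vars (Exists x \<phi>)"
  have fv: "free_vars \<phi> \<subseteq> insert x ?W" by auto
  have "card (free_vars \<phi>) \<le> card (insert x ?W)"
    using fv by (intro card_mono) (auto simp: finite_free_vars)
  also have "\<dots> \<le> Suc (card ?W)"
    by (metis card.infinite card_insert_if eq_iff finite_insert le_SucI zero_le)
  finally have k: "card (free_vars \<phi>) + quantifier_rank \<phi> \<le> k" "card ?W \<le> k"
    using Exists.prems(1) by auto
  show ?case
  proof
    assume "sat X e (Exists x \<phi>)"
    then obtain a where a: "a \<in> univ X" "sat X (e(x := a)) \<phi>" by auto
    obtain b where b: "b \<in> univ Y" "same_type (insert x ?W) X (e(x := a)) Y (f(x := b))"
      using same_type_extend[OF Exists.prems(2) _ _ k(2) assms(1,3,4) a(1), of x] finite_free_vars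
      by auto
    then show "sat Y f (Exists x \<phi>)"
      using Exists.IH[OF k(1) same_type_subset[OF b(2) fv]] a(2) b(1) unfolding sat.simps by blast
  next
    assume "sat Y f (Exists x \<phi>)"
    then obtain b where b: "b \<in> univ Y" "sat Y (f(x := b)) \<phi>" by auto
    obtain a where a: "a \<in> univ X" "same_type (insert x ?W) Y (f(x := b)) X (e(x := a))"
      using same_type_extend[OF same_type_sym[OF Exists.prems(2)] _ _ k(2) assms(3,1,2) b(1), of x]
        finite_free_vars by auto
    then show "sat X e (Exists x \<phi>)"
      using Exists.IH[OF k(1) same_type_subset[OF same_type_sym[OF a(2)] fv]] b(2) a(1)
      unfolding sat.simps by blast
  qed
qed

text \<open>A sentence starts from the type over no variables. The only tuple there is the empty
  one, and \<open>0 < d\<close> keeps it out of both relations.\<close>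

lemma models_extension_property:
  assumes "distinct_structure d X" "extension_property d (quantifier_rank \<phi>) X"
    and "distinct_structure d Y" "extension_property d (quantifier_rank \<phi>) Y"
    and "free_vars \<phi> = {}" and "0 < d"
  shows "X \<Turnstile> \<phi> \<longleftrightarrow> Y \<Turnstile> \<phi>"
proof -
  have "sat X e \<phi> \<longleftrightarrow> sat Y f \<phi>" for e f
    using assms by (intro sat_same_type[of d]) (auto simp: same_type_def distinct_structure_def)
  then show ?thesis unfolding models_def by blast
qed

section \<open>Probability of the extension axioms when every tuple is independent\<close>

lemma hyperedges_trivial: "hyperedges d {id} n = (\<lambda>v. {v}) ` distinct_tuples n d"
  by (auto simp: hyperedges_def tuple_orbit_def distinct_tuples_def tuple_act_id intro!: image_cong)

lemma card_templates_le:
  assumes "finite A" "card A \<le> k"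
  shows "finite (templates d A)" "card (templates d A) \<le> Suc k ^ d"
proof -
  let ?L = "{xs. set xs \<subseteq> insert 0 A \<and> length xs = d}"
  have sub: "templates d A \<subseteq> ?L" and fin: "finite ?L"
    using assms(1) by (auto simp: templates_def intro!: finite_lists_length_eq)
  show "finite (templates d A)"
    using sub fin by (rule finite_subset)
  have "card (templates d A) \<le> card ?L"
    using sub fin by (rule card_mono[rotated])
  also have "\<dots> = card (insert 0 A) ^ d"
    using assms(1) by (simp add: card_lists_length_eq)
  also have "\<dots> \<le> Suc k ^ d"
    using assms by (intro power_mono) (auto simp: card_insert_if)
  finally show "card (templates d A) \<le> Suc k ^ d" .
qed

text \<open>Each of the at least \<open>n - k\<close> candidates \<open>b\<close> owns the block of
  tuples obtained by filling templates with \<open>b\<close>. The block size is bounded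
  independently of \<open>n\<close>, so the block estimate applies.\<close>

lemma prob_no_witness_le:
  assumes p: "0 < p" "p < 1" and A: "A \<subseteq> {1..n}" "card A \<le> k"
  shows "measure_pmf.prob (Pi_pmf (hyperedges d {id} n) False (\<lambda>_. bernoulli_pmf p))
      {\<omega>. \<forall>b\<in>{1..n} - A. \<exists>v\<in>templates d A. \<omega> {map (id(0 := b)) v} \<noteq> (v \<in> S)}
    \<le> (1 - min p (1 - p) ^ (Suc k ^ d)) ^ (n - k)"
proof -
  have finA: "finite A" using A(1) finite_subset by blast
  define J where "J = {1..n} - A"
  \<comment> \<open>\<open>B b\<close> and \<open>s b\<close> restate templates and prescription on
    hyperedges, which are singletons here; by \<open>mapinj\<close> the filled tuple determines its
    template, so \<open>s b\<close> agrees with \<open>S\<close>.\<close>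
  define B where "B b = (\<lambda>v. {map (id(0 := b)) v}) ` templates d A" for b
  define s where "s b E \<longleftrightarrow> E \<in> (\<lambda>v. {map (id(0 := b)) v}) ` (S \<inter> templates d A)" for b E
  have inj: "inj_on (id(0 := b)) (insert 0 A)" if "b \<in> J" for b
    using that A(1) by (auto simp: inj_on_def J_def)
  have mapinj: "map (id(0 := b)) v = map (id(0 := b)) w \<longleftrightarrow> v = w"
    if "b \<in> J" "v \<in> templates d A" "w \<in> templates d A" for b v w
    using that by (intro inj_on_map_eq_map inj_on_subset[OF inj]) (auto simp: templates_def)
  have s: "s b {map (id(0 := b)) v} \<longleftrightarrow> v \<in> S" if "b \<in> J" "v \<in> templates d A" for b v
    using that mapinj by (auto simp: s_def)
  have BI: "B b \<subseteq> hyperedges d {id} n" if b: "b \<in> J" for b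
  proof -
    have "map (id(0 := b)) v \<in> distinct_tuples n d" if v: "v \<in> templates d A" for v
      using v b A(1) inj_on_subset[OF inj[OF b], of "set v"]
      by (auto simp: distinct_tuples_def templates_def distinct_map J_def)
    then show ?thesis by (auto simp: B_def hyperedges_trivial)
  qed
  \<comment> \<open>A filled template really contains \<open>b\<close>, and \<open>b\<close> is its
    only entry outside \<open>A\<close>, so the tuple determines \<open>b\<close>.\<close>
  have disj: "disjoint_family_on B J"
  proof -
    have "b = c" if "b \<in> J" "c \<in> J" "v \<in> templates d A" "w \<in> templates d A"
      "map (id(0 := b)) v = map (id(0 := c)) w" for b c v w
    proof -
      have "b \<in> set (map (id(0 := b)) v)"
        using that(3) by (force simp: templates_def)
      then have "b \<in> (id(0 := c)) ` set w"
        unfolding that(5) by simp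
      then show ?thesis
        using that by (auto simp: templates_def J_def split: if_splits)
    qed
    then show ?thesis by (auto simp: disjoint_family_on_def B_def)
  qed
  have cardB: "card (B b) \<le> Suc k ^ d" for b
    unfolding B_def using card_templates_le[OF finA A(2), of d] card_image_le le_trans by blast
  let ?r = "1 - min p (1 - p) ^ (Suc k ^ d)"
  have r: "0 \<le> ?r" "?r \<le> 1"
    using p by (auto simp: power_le_one)
  have "{\<omega>. \<forall>b\<in>{1..n} - A. \<exists>v\<in>templates d A. \<omega> {map (id(0 := b)) v} \<noteq> (v \<in> S)} =
      {\<omega>. \<forall>b\<in>J. \<exists>E\<in>B b. \<omega> E \<noteq> s b E}"
    using s by (auto simp: J_def B_def)
  then have "measure_pmf.prob (Pi_pmf (hyperedges d {id} n) False (\<lambda>_. bernoulli_pmf p))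
      {\<omega>. \<forall>b\<in>{1..n} - A. \<exists>v\<in>templates d A. \<omega> {map (id(0 := b)) v} \<noteq> (v \<in> S)} \<le> ?r ^ card J"
    using prob_all_blocks_mismatch_le[of J "hyperedges d {id} n" B p "Suc k ^ d" False s]
      BI disj cardB p finite_hyperedges by (simp add: J_def)
  also have "n - k \<le> card J"
    using A finA by (simp add: J_def card_Diff_subset)
  then have "?r ^ card J \<le> ?r ^ (n - k)"
    using r by (rule power_decreasing)
  finally show ?thesis .
qed

text \<open>A set of at most \<open>k\<close> elements is listed, padded to length \<open>k\<close>
  with \<open>0\<close>, and recovered by deleting the padding, since \<open>0\<close> is not in
  \<open>{1..n}\<close>.\<close>

lemma card_small_subsets_le: "card {A. A \<subseteq> {1..n} \<and> card A \<le> k} \<le> Suc n ^ k"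
proof -
  have "{A. A \<subseteq> {1..n} \<and> card A \<le> k} \<subseteq> (\<lambda>xs. set xs - {0}) ` {xs. set xs \<subseteq> {0..n} \<and> length xs = k}"
  proof clarify
    fix A :: "nat set" assume A: "A \<subseteq> {1..n}" "card A \<le> k"
    then obtain xs where xs: "set xs = A" "length xs = card A"
      by (metis finite_atLeastAtMost finite_distinct_list finite_subset distinct_card)
    show "A \<in> (\<lambda>xs. set xs - {0}) ` {xs. set xs \<subseteq> {0..n} \<and> length xs = k}"
      using A xs by (intro image_eqI[where x = "xs @ replicate (k - card A) 0"])
        (auto simp: set_replicate_conv_if)
  qed
  then have "card {A. A \<subseteq> {1..n} \<and> card A \<le> k} \<le> card {xs. set xs \<subseteq> {0..n} \<and> length xs = k}"
    by (rule surj_card_le[rotated]) (simp add: finite_lists_length_eq)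
  then show ?thesis
    by (simp add: card_lists_length_eq)
qed

text \<open>Union bound: at most \<open>(n+1)^k\<close> sets \<open>A\<close>, at most
  \<open>2 ^ (Suc k ^ d)\<close> prescriptions for each, and \<open>prob_no_witness_le\<close> for
  every pair.\<close>

lemma prob_not_extension_property_le:
  assumes p: "0 < p" "p < 1"
  shows "measure_pmf.prob (binomial_hypergraph d {id} n p) {X. \<not> extension_property d k X}
    \<le> real (Suc n) ^ k * (2 ^ (Suc k ^ d) * (1 - min p (1 - p) ^ (Suc k ^ d)) ^ (n - k))"
proof -
  let ?P = "Pi_pmf (hyperedges d {id} n) False (\<lambda>_. bernoulli_pmf p)"
  let ?r = "(1 - min p (1 - p) ^ (Suc k ^ d)) ^ (n - k)"
  let ?\<A> = "{A. A \<subseteq> {1..n} \<and> card A \<le> k}"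
  define F where "F A S =
    {\<omega>. \<forall>b\<in>{1..n} - A. \<exists>v\<in>templates d A. \<omega> {map (id(0 := b)) v} \<noteq> (v \<in> S)}" for A S
  have r: "0 \<le> ?r"
    using p by (auto simp: power_le_one)
  have fin: "finite (templates d A)" "card (templates d A) \<le> Suc k ^ d" if "A \<in> ?\<A>" for A
    using that card_templates_le[of A k d] finite_subset[of A "{1..n}"] by auto
  have "\<omega> \<in> (\<Union>A\<in>?\<A>. \<Union>S\<in>Pow (templates d A). F A S)"
    if not_ep: "\<not> extension_property d k (Struct {1..n} (\<lambda>_. \<Union>{E \<in> hyperedges d {id} n. \<omega> E}))" for \<omega>
  proof -
    define R where "R = \<Union>{E \<in> hyperedges d {id} n. \<omega> E}"
    obtain A S where A: "A \<subseteq> {1..n}" "card A \<le> k"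
      and S: "\<not> (\<exists>b\<in>{1..n} - A. \<forall>v\<in>templates d A. map (id(0 := b)) v \<in> R \<longleftrightarrow> v \<in> S)"
      using not_ep unfolding extension_property_def struct.sel R_def[symmetric] by metis
    have mem: "map (id(0 := b)) v \<in> R \<longleftrightarrow> \<omega> {map (id(0 := b)) v}"
      if b: "b \<in> {1..n} - A" and v: "v \<in> templates d A" for b v
    proof -
      have "inj_on (id(0 := b)) (set v)"
        using b v A(1) by (auto simp: inj_on_def templates_def)
      then have "map (id(0 := b)) v \<in> distinct_tuples n d"
        using b v A(1) by (auto simp: distinct_tuples_def templates_def distinct_map)
      then show ?thesis
        by (auto simp: hyperedges_trivial R_def)
    qed
    \<comment> \<open>Cutting \<open>S\<close> down to the templates prescribes the same and leaves
      a finite union.\<close>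
    have "\<omega> \<in> F A (S \<inter> templates d A)"
      unfolding F_def
    proof (intro CollectI ballI)
      fix b assume b: "b \<in> {1..n} - A"
      obtain v where v: "v \<in> templates d A"
        "(map (id(0 := b)) v \<in> R) \<noteq> (v \<in> S)"
        using S b by metis
      then show "\<exists>v\<in>templates d A. \<omega> {map (id(0 := b)) v} \<noteq> (v \<in> S \<inter> templates d A)"
        using mem[OF b v(1)] by blast
    qed
    then show ?thesis
      using A by (intro UN_I[of A] UN_I[of "S \<inter> templates d A"]) simp_all
  qed
  then have "measure_pmf.prob (binomial_hypergraph d {id} n p) {X. \<not> extension_property d k X}
      \<le> measure_pmf.prob ?P (\<Union>A\<in>?\<A>. \<Union>S\<in>Pow (templates d A). F A S)"
    unfolding binomial_hypergraph_def measure_map_pmf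
    by (intro measure_pmf.finite_measure_mono) auto
  also have "\<dots> \<le> (\<Sum>A\<in>?\<A>. measure_pmf.prob ?P (\<Union>S\<in>Pow (templates d A). F A S))"
    by (intro measure_pmf.finite_measure_subadditive_finite) auto
  also have "\<dots> \<le> real (card ?\<A>) * (2 ^ (Suc k ^ d) * ?r)"
  proof (rule sum_bounded_above)
    fix A assume A: "A \<in> ?\<A>"
    have "measure_pmf.prob ?P (\<Union>S\<in>Pow (templates d A). F A S)
        \<le> (\<Sum>S\<in>Pow (templates d A). measure_pmf.prob ?P (F A S))"
      using fin[OF A] by (intro measure_pmf.finite_measure_subadditive_finite) auto
    also have "\<dots> \<le> real (card (Pow (templates d A))) * ?r"
      using A unfolding F_def by (intro sum_bounded_above prob_no_witness_le p) auto
    also have "real (card (Pow (templates d A))) = 2 ^ card (templates d A)"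
      using fin[OF A] by (simp add: card_Pow)
    also have "2 ^ card (templates d A) * ?r \<le> 2 ^ (Suc k ^ d) * ?r"
      using fin[OF A] r by (intro mult_right_mono power_increasing) auto
    finally show "measure_pmf.prob ?P (\<Union>S\<in>Pow (templates d A). F A S) \<le> 2 ^ (Suc k ^ d) * ?r" .
  qed
  also have "\<dots> \<le> real (Suc n ^ k) * (2 ^ (Suc k ^ d) * ?r)"
    using r card_small_subsets_le[of n k] by (intro mult_right_mono of_nat_mono) auto
  finally show ?thesis by simp
qed

lemma prob_not_extension_property_tendsto:
  assumes p: "0 < p" "p < 1"
  shows "(\<lambda>n. measure_pmf.prob (binomial_hypergraph d {id} n p) {X. \<not> extension_property d k X}) \<longlonglongrightarrow> 0"
proof -
  define r where "r = 1 - min p (1 - p) ^ (Suc k ^ d)"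
  define C where "C = (2::real) ^ (Suc k ^ d)"
  have "min p (1 - p) ^ (Suc k ^ d) < 1"
    using p by (intro power_less_one_iff[THEN iffD2]) auto
  then have r: "0 < r" "r < 1"
    using p by (auto simp: r_def)
  have "(\<lambda>n. real (Suc n) ^ k * r ^ n) \<longlonglongrightarrow> 0"
    using r by real_asymp
  then have "(\<lambda>n. (C / r ^ k) * (real (Suc n) ^ k * r ^ n)) \<longlonglongrightarrow> 0"
    by (rule tendsto_mult_right_zero)
  \<comment> \<open>Subtraction on naturals truncates, so \<open>r ^ (n - k)\<close> is the quotient
    of powers only from \<open>n = k\<close> on; dividing uses \<open>0 < r\<close>.\<close>
  moreover have "\<forall>\<^sub>F n in sequentially.
      (C / r ^ k) * (real (Suc n) ^ k * r ^ n) = real (Suc n) ^ k * (C * r ^ (n - k))"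
    using eventually_ge_at_top[of k] by eventually_elim (use r in \<open>simp add: power_diff\<close>)
  ultimately have "(\<lambda>n. real (Suc n) ^ k * (C * r ^ (n - k))) \<longlonglongrightarrow> 0"
    by (rule Lim_transform_eventually)
  then show ?thesis
  proof (rule tendsto_sandwich[OF _ _ tendsto_const, rotated 2])
    show "\<forall>\<^sub>F n in sequentially.
        measure_pmf.prob (binomial_hypergraph d {id} n p) {X. \<not> extension_property d k X}
        \<le> real (Suc n) ^ k * (C * r ^ (n - k))"
      unfolding r_def C_def by (intro always_eventually allI prob_not_extension_property_le p)
  qed simp
qed

section \<open>The 0--1 law, first for the trivial group\<close>

lemma fo_zero_one_law_trivial_group:
  assumes p: "0 < p" "p < 1" and d: "0 < d"
  shows "fo_zero_one_law (hypergraph_sig d) (\<lambda>n. binomial_hypergraph d {id} n p)"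
  unfolding fo_zero_one_law_def
proof (intro allI impI)
  fix \<phi> assume "fo_sentence (hypergraph_sig d) \<phi>"
  then have fv: "free_vars \<phi> = {}" by (simp add: fo_sentence_def)
  let ?D = "\<lambda>n. binomial_hypergraph d {id} n p"
  \<comment> \<open>A sentence has no free variables, so its quantifier rank alone is the required
    number of old vertices.\<close>
  let ?bad = "{X. \<not> extension_property d (quantifier_rank \<phi>) X}"
  have distinct: "distinct_structure d X" if "X \<in> set_pmf (?D n)" for X n
  proof -
    have "univ X = {1..n}" "rel X () \<subseteq> distinct_tuples n d"
      using that by (auto simp: binomial_hypergraph_def hyperedges_trivial)
    then show ?thesis
      by (simp add: distinct_structure_def distinct_tuples_def)
  qed
  have bad: "(\<lambda>n. measure_pmf.prob (?D n) ?bad) \<longlonglongrightarrow> 0"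
    by (rule prob_not_extension_property_tendsto[OF p])
  have small: "(\<lambda>n. measure_pmf.prob (?D n) A) \<longlonglongrightarrow> 0"
    if "\<And>n X. X \<in> set_pmf (?D n) \<Longrightarrow> X \<in> A \<Longrightarrow> X \<in> ?bad" for A
  proof (rule tendsto_sandwich[OF _ _ tendsto_const bad])
    show "\<forall>\<^sub>F n in sequentially. measure_pmf.prob (?D n) A \<le> measure_pmf.prob (?D n) ?bad"
    proof (rule always_eventually, rule allI, rule measure_pmf.finite_measure_mono_AE)
      show "AE X in ?D n. X \<in> A \<longrightarrow> X \<in> ?bad" for n
        unfolding AE_measure_pmf_iff using that by blast
    qed simp
  qed simp
  show "(\<lambda>n. prob_models (?D n) \<phi>) \<longlonglongrightarrow> 0 \<or> (\<lambda>n. prob_models (?D n) \<phi>) \<longlonglongrightarrow> 1"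
  \<comment> \<open>All structures with the extension property agree on \<open>\<phi>\<close>. If
    one of them satisfies it, \<open>\<phi>\<close> can fail only on bad samples; if none does, it
    can hold only on bad samples.\<close>
  proof (cases "\<exists>X. distinct_structure d X \<and> extension_property d (quantifier_rank \<phi>) X \<and> X \<Turnstile> \<phi>")
    case True
    then have "(\<lambda>n. measure_pmf.prob (?D n) {X. \<not> X \<Turnstile> \<phi>}) \<longlonglongrightarrow> 0"
      using models_extension_property[OF _ _ _ _ fv d] distinct by (intro small) blast
    then have "(\<lambda>n. 1 - measure_pmf.prob (?D n) {X. \<not> X \<Turnstile> \<phi>}) \<longlonglongrightarrow> 1 - 0"
      by (intro tendsto_diff tendsto_const)
    moreover have "1 - measure_pmf.prob (?D n) {X. \<not> X \<Turnstile> \<phi>} = prob_models (?D n) \<phi>" for n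
      using measure_pmf.prob_compl[of "{X. \<not> X \<Turnstile> \<phi>}" "?D n"]
      by (simp add: prob_models_def Compl_eq_Diff_UNIV[symmetric] Collect_neg_eq[symmetric])
    ultimately show ?thesis by simp
  next
    case False
    then have "(\<lambda>n. prob_models (?D n) \<phi>) \<longlonglongrightarrow> 0"
      unfolding prob_models_def using distinct by (intro small) blast
    then show ?thesis ..
  qed
qed

theorem theorem6:
  fixes d :: nat and H K :: "(nat \<Rightarrow> nat) set" and p :: "nat \<Rightarrow> real"
  assumes "d \<ge> 1"
    and "subgroup H (sym_group d)"
    and "subgroup K ((sym_group d)\<lparr>carrier := H\<rparr>)"
    and "\<And>n. 0 < p n \<and> p n < 1"
  shows "fo_reducible
           (hypergraph_sig d) (\<lambda>n. binomial_hypergraph d H n (p n ^ subgroup_index (sym_group d) H K))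
           (hypergraph_sig d) (\<lambda>n. binomial_hypergraph d K n (p n))
       \<and> (\<forall>q::real. 0 < q \<and> q < 1 \<longrightarrow>
            fo_zero_one_law (hypergraph_sig d) (\<lambda>n. binomial_hypergraph d H n q))"
proof (intro conjI allI impI)
  show "fo_reducible
           (hypergraph_sig d) (\<lambda>n. binomial_hypergraph d H n (p n ^ subgroup_index (sym_group d) H K))
           (hypergraph_sig d) (\<lambda>n. binomial_hypergraph d K n (p n))"
    using assms by (intro fo_reducible_binomial_hypergraph) (auto intro: less_imp_le)
next
  fix q :: real assume q: "0 < q \<and> q < 1"
  have "group ((sym_group d)\<lparr>carrier := H\<rparr>)"
    by (rule subgroup.subgroup_is_group[OF assms(2) sym_group_is_group])
  then have triv: "subgroup {id} ((sym_group d)\<lparr>carrier := H\<rparr>)"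
    using group.triv_subgroup[of "(sym_group d)\<lparr>carrier := H\<rparr>"] by (simp add: sym_group_one)
  let ?m = "subgroup_index (sym_group d) H {id}"
  have "finite (rcosets\<^bsub>(sym_group d)\<lparr>carrier := H\<rparr>\<^esub> {id})"
    using finite_subgroup_sym_group[OF assms(2)] by (simp add: RCOSETS_def)
  moreover have "rcosets\<^bsub>(sym_group d)\<lparr>carrier := H\<rparr>\<^esub> {id} \<noteq> {}"
    using subgroup_sym_groupD(2)[OF assms(2)] by (auto simp: RCOSETS_def)
  ultimately have m: "0 < ?m"
    by (simp add: subgroup_index_def card_gt_0_iff)
  \<comment> \<open>Since \<open>?m\<close> is positive, the root lies strictly between
    \<open>0\<close> and \<open>1\<close> and its \<open>?m\<close>-th power is \<open>q\<close>
    again, so the reduction hits \<open>q\<close> exactly.\<close>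
  define c where "c = root ?m q"
  have c: "0 < c" "c < 1" "c ^ ?m = q"
    using m q by (auto simp: c_def)
  have "fo_reducible (hypergraph_sig d) (\<lambda>n. binomial_hypergraph d H n (c ^ ?m))
      (hypergraph_sig d) (\<lambda>n. binomial_hypergraph d {id} n c)"
    using c(1,2) by (intro fo_reducible_binomial_hypergraph[OF assms(2) triv]) auto
  then show "fo_zero_one_law (hypergraph_sig d) (\<lambda>n. binomial_hypergraph d H n q)"
    unfolding c(3)
    by (rule fo_zero_one_law_reducible) (use assms(1) c in \<open>auto intro: fo_zero_one_law_trivial_group\<close>)
qed

end
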